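(* Consider the generalized ARCH model $$X_t=\sigma_t\epsilon_t,\qquad \sigma_t^2=\alpha_0+\alpha_1X_{t-1}^2+l_1L_{t-1},\qquad t\in\mathbb{Z},$$ with $\alpha_0\ge 0$, $\alpha_1,l_1>0$. Suppose $\alpha_1<1$ and $\mathbb{E}(L_0^2)<\infty$. Then, in the class of processes satisfying $\sup_{t\in\mathbb{Z}}\mathbb{E}(\sigma_t^2)<\infty$, the model has a unique solution, and it is given by $$\sigma_{t+1}^2=\sum_{i=0}^\infty\left(\prod_{j=0}^{i-1}A_{t-j}\right)B_{t-i},\qquad t\in\mathbb{Z},$$ where $A_t=\alpha_1\epsilon_t^2$ and $B_t=\alpha_0+l_1L_t$.
   Context: Standing assumptions on the model: $(\epsilon_t)_{t\in\mathbb{Z}}$ is an i.i.d. process with $\mathbb{E}(\epsilon_0)=0$ and $\mathbb{E}(\epsilon_0^2)=1$; $(L_t)_{t\in\mathbb{Z}}$ (the liquidity) is a strictly stationary positive process with $\mathbb{E}(L_0)=1$, independent of $(\epsilon_t)_{t\in\mathbb{Z}}$. The empty product is $1$. Since $X_t^2=\sigma_t^2\epsilon_t^2$, being a solution means that the nonnegative process $(\sigma_t^2)_{t\in\mathbb{Z}}$ satisfies $\sigma_{t+1}^2=A_t\sigma_t^2+B_t$ almost surely for every $t\in\mathbb{Z}$. Uniqueness means that any two solutions $\sigma^2,\tilde\sigma^2$ in the class satisfy $\sigma_t^2=\tilde\sigma_t^2$ almost surely for every $t\in\mathbb{Z}$. *)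

theory Defs
  imports "HOL-Probability.Probability"
begin

definition iid_process :: "'a measure \<Rightarrow> (int \<Rightarrow> 'a \<Rightarrow> real) \<Rightarrow> bool" where
  "iid_process M X \<longleftrightarrow>
     prob_space.indep_vars M (\<lambda>_. borel) X UNIV \<and>
     (\<forall>s t. distr M borel (X s) = distr M borel (X t))"

definition strictly_stationary :: "'a measure \<Rightarrow> (int \<Rightarrow> 'a \<Rightarrow> real) \<Rightarrow> bool" where
  "strictly_stationary M X \<longleftrightarrow>
     (\<forall>t. X t \<in> borel_measurable M) \<and>
     (\<forall>J h. finite J \<longrightarrow>
        distr M (Pi\<^sub>M J (\<lambda>_. borel)) (\<lambda>\<omega>. \<lambda>t\<in>J. X (t + h) \<omega>) =
        distr M (Pi\<^sub>M J (\<lambda>_. borel)) (\<lambda>\<omega>. \<lambda>t\<in>J. X t \<omega>))"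

text \<open>Independence of the two whole trajectories, as random elements of the
  product space over all integer times.\<close>

definition indep_processes ::
    "'a measure \<Rightarrow> (int \<Rightarrow> 'a \<Rightarrow> real) \<Rightarrow> (int \<Rightarrow> 'a \<Rightarrow> real) \<Rightarrow> bool" where
  "indep_processes M X Y \<longleftrightarrow>
     prob_space.indep_var M (Pi\<^sub>M UNIV (\<lambda>_. borel)) (\<lambda>\<omega> t. X t \<omega>)
                            (Pi\<^sub>M UNIV (\<lambda>_. borel)) (\<lambda>\<omega> t. Y t \<omega>)"

definition arch_A :: "real \<Rightarrow> (int \<Rightarrow> 'a \<Rightarrow> real) \<Rightarrow> int \<Rightarrow> 'a \<Rightarrow> real" where
  "arch_A \<alpha>\<^sub>1 \<epsilon> t \<omega> = \<alpha>\<^sub>1 * (\<epsilon> t \<omega>)\<^sup>2"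

definition arch_B :: "real \<Rightarrow> real \<Rightarrow> (int \<Rightarrow> 'a \<Rightarrow> real) \<Rightarrow> int \<Rightarrow> 'a \<Rightarrow> real" where
  "arch_B \<alpha>\<^sub>0 l\<^sub>1 L t \<omega> = \<alpha>\<^sub>0 + l\<^sub>1 * L t \<omega>"

text \<open>The unknown \<open>S\<close> is the squared volatility process, \<open>S t = \<sigma>\<^sub>t\<^sup>2\<close>. No adaptedness or
  independence of \<open>S\<close> from the innovations is imposed.\<close>

definition arch_solution ::
    "'a measure \<Rightarrow> real \<Rightarrow> real \<Rightarrow> real \<Rightarrow> (int \<Rightarrow> 'a \<Rightarrow> real) \<Rightarrow> (int \<Rightarrow> 'a \<Rightarrow> real)
      \<Rightarrow> (int \<Rightarrow> 'a \<Rightarrow> real) \<Rightarrow> bool" where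
  "arch_solution M \<alpha>\<^sub>0 \<alpha>\<^sub>1 l\<^sub>1 \<epsilon> L S \<longleftrightarrow>
     (\<forall>t. S t \<in> borel_measurable M) \<and>
     (\<forall>t. AE \<omega> in M. 0 \<le> S t \<omega>) \<and>
     (\<forall>t. AE \<omega> in M. S (t + 1) \<omega> = arch_A \<alpha>\<^sub>1 \<epsilon> t \<omega> * S t \<omega> + arch_B \<alpha>\<^sub>0 l\<^sub>1 L t \<omega>)"

text \<open>The recursion is the model equation \<open>\<sigma>\<^sub>t\<^sup>2 = \<alpha>\<^sub>0 + \<alpha>\<^sub>1 X\<^bsub>t-1\<^esub>\<^sup>2 + l\<^sub>1 L\<^bsub>t-1\<^esub>\<close> with
  \<open>X\<^sub>t = \<sigma>\<^sub>t \<epsilon>\<^sub>t\<close>.\<close>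

lemma arch_solution_iff_model:
  "arch_solution M \<alpha>\<^sub>0 \<alpha>\<^sub>1 l\<^sub>1 \<epsilon> L S \<longleftrightarrow>
     (\<forall>t. S t \<in> borel_measurable M) \<and>
     (\<forall>t. AE \<omega> in M. 0 \<le> S t \<omega>) \<and>
     (\<forall>t. AE \<omega> in M. S t \<omega> =
        \<alpha>\<^sub>0 + \<alpha>\<^sub>1 * (sqrt (S (t - 1) \<omega>) * \<epsilon> (t - 1) \<omega>)\<^sup>2 + l\<^sub>1 * L (t - 1) \<omega>)"
proof -
  have shift: "(\<forall>t. P (t + 1) t) \<longleftrightarrow> (\<forall>t. P t (t - 1))" for P :: "int \<Rightarrow> int \<Rightarrow> bool"
    by (metis add_diff_cancel_right' diff_add_cancel)
  have "(AE \<omega> in M. S u \<omega> = arch_A \<alpha>\<^sub>1 \<epsilon> v \<omega> * S v \<omega> + arch_B \<alpha>\<^sub>0 l\<^sub>1 L v \<omega>) \<longleftrightarrow>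
        (AE \<omega> in M. S u \<omega> = \<alpha>\<^sub>0 + \<alpha>\<^sub>1 * (sqrt (S v \<omega>) * \<epsilon> v \<omega>)\<^sup>2 + l\<^sub>1 * L v \<omega>)"
    if "AE \<omega> in M. 0 \<le> S v \<omega>" for u v
    by (rule eventually_subst, rule eventually_mono[OF that])
       (simp add: arch_A_def arch_B_def power_mult_distrib algebra_simps)
  then show ?thesis
    unfolding arch_solution_def
    using shift[of "\<lambda>u v. AE \<omega> in M. S u \<omega> = arch_A \<alpha>\<^sub>1 \<epsilon> v \<omega> * S v \<omega> + arch_B \<alpha>\<^sub>0 l\<^sub>1 L v \<omega>"]
    by blast
qed

text \<open>For an almost surely nonnegative process the integral below is the expectation of
  \<open>S t\<close>, with value \<open>\<infinity>\<close> if \<open>S t\<close> is not integrable.\<close>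

definition bounded_mean :: "'a measure \<Rightarrow> (int \<Rightarrow> 'a \<Rightarrow> real) \<Rightarrow> bool" where
  "bounded_mean M S \<longleftrightarrow> (SUP t. \<integral>\<^sup>+ \<omega>. ennreal (S t \<omega>) \<partial>M) < \<infinity>"

end

theory Submission
  imports Defs
begin

text \<open>Iterating the recursion \<open>n\<close> times writes \<open>S (t + 1)\<close> as the \<open>n\<close>-th partial sum of the
  series plus the remainder \<open>(\<Prod>j<n. A (t - j)) * S (t + 1 - n)\<close>. A solution need not be
  adapted, so the expectation of this remainder does not factorise. Instead put \<open>r = sqrt \<alpha>\<^sub>1\<close>:
  the expectations of \<open>(\<Prod>j<n. A (t - j)) / r ^ n\<close> and of \<open>r ^ n * S (t + 1 - n)\<close> are both
  \<open>O(r ^ n)\<close>, hence summable, so both factors, and with them the remainder, tend to \<open>0\<close> almost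
  surely. Existence holds because the terms of the series have expectation
  \<open>\<alpha>\<^sub>1 ^ i * (\<alpha>\<^sub>0 + l\<^sub>1)\<close>.\<close>

section \<open>Expectations of series, of independent products and of stationary marginals\<close>

text \<open>By Tonelli the sum has finite expectation, so it is finite almost surely. This serves
  both the convergence of the solution series and, since terms of a convergent series vanish, the
  remainder estimate.\<close>

lemma AE_summable_nn_integral:
  fixes f :: "nat \<Rightarrow> 'a \<Rightarrow> real"
  assumes meas [measurable]: "\<And>n. f n \<in> borel_measurable M"
    and nonneg: "\<And>n. AE \<omega> in M. 0 \<le> f n \<omega>"
    and bound: "\<And>n. (\<integral>\<^sup>+\<omega>. ennreal (f n \<omega>) \<partial>M) \<le> ennreal (c n)"
    and c: "\<And>n. 0 \<le> c n" "summable c"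
  shows "AE \<omega> in M. summable (\<lambda>n. f n \<omega>)"
proof -
  have "(\<integral>\<^sup>+\<omega>. (\<Sum>n. ennreal (f n \<omega>)) \<partial>M) = (\<Sum>n. \<integral>\<^sup>+\<omega>. ennreal (f n \<omega>) \<partial>M)"
    by (rule nn_integral_suminf) simp
  also have "\<dots> \<le> (\<Sum>n. ennreal (c n))"
    by (intro suminf_le bound) auto
  also have "\<dots> = ennreal (\<Sum>n. c n)"
    by (rule suminf_ennreal2) fact+
  finally have "(\<integral>\<^sup>+\<omega>. (\<Sum>n. ennreal (f n \<omega>)) \<partial>M) \<noteq> \<infinity>"
    by (auto simp: top_unique)
  then have "AE \<omega> in M. (\<Sum>n. ennreal (f n \<omega>)) \<noteq> \<infinity>"
    by (intro nn_integral_PInf_AE) auto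
  moreover have "AE \<omega> in M. \<forall>n. 0 \<le> f n \<omega>"
    using nonneg by (simp add: AE_all_countable)
  ultimately show ?thesis
    by eventually_elim (auto intro: summable_suminf_not_top)
qed

lemma (in prob_space) indep_var_nn_integral:
  fixes X Y :: "'a \<Rightarrow> ennreal"
  assumes "indep_var borel X borel Y"
  shows "(\<integral>\<^sup>+\<omega>. X \<omega> * Y \<omega> \<partial>M) = (\<integral>\<^sup>+\<omega>. X \<omega> \<partial>M) * (\<integral>\<^sup>+\<omega>. Y \<omega> \<partial>M)"
proof -
  \<comment> \<open>\<open>indep_var\<close> is \<open>indep_vars\<close> over \<open>bool\<close>
    with codomains given by \<open>case_bool\<close>; this family has to be recognised as constant
    before the product rule for families applies.\<close>
  have "(\<lambda>b. case_bool borel borel b) = (\<lambda>_::bool. borel :: ennreal measure)"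
    by (auto split: bool.split)
  then have "indep_vars (\<lambda>_. borel) (case_bool X Y) UNIV"
    using assms unfolding indep_var_def by simp
  from indep_vars_nn_integral[OF _ this] show ?thesis
    by (simp add: UNIV_bool mult.commute)
qed

text \<open>Stationarity compares laws on finite product spaces. The index set \<open>{0}\<close>
  with shift \<open>t\<close> yields equal one-dimensional laws, read off through the coordinate at
  \<open>0\<close>.\<close>

lemma strictly_stationary_nn_integral:
  fixes f :: "real \<Rightarrow> ennreal"
  assumes "strictly_stationary M X" and [measurable]: "f \<in> borel_measurable borel"
  shows "(\<integral>\<^sup>+\<omega>. f (X t \<omega>) \<partial>M) = (\<integral>\<^sup>+\<omega>. f (X 0 \<omega>) \<partial>M)"
proof -
  have [measurable]: "X s \<in> borel_measurable M" for s
    using assms by (simp add: strictly_stationary_def)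
  have [measurable]: "(\<lambda>x. f (x 0)) \<in> borel_measurable (Pi\<^sub>M {0::int} (\<lambda>_. borel))"
    by (rule measurable_compose[OF measurable_component_singleton]) auto
  have marginal: "(\<integral>\<^sup>+x. f (x 0) \<partial>distr M (Pi\<^sub>M {0::int} (\<lambda>_. borel)) (\<lambda>\<omega>. \<lambda>s\<in>{0}. X (s + h) \<omega>))
      = (\<integral>\<^sup>+\<omega>. f (X h \<omega>) \<partial>M)" for h
    by (subst nn_integral_distr) auto
  \<comment> \<open>The right-hand side keeps \<open>s + 0\<close> so that \<open>marginal\<close>
    matches both sides.\<close>
  have "distr M (Pi\<^sub>M {0::int} (\<lambda>_. borel)) (\<lambda>\<omega>. \<lambda>s\<in>{0}. X (s + t) \<omega>) =
      distr M (Pi\<^sub>M {0::int} (\<lambda>_. borel)) (\<lambda>\<omega>. \<lambda>s\<in>{0}. X (s + 0) \<omega>)"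
    using assms(1) unfolding strictly_stationary_def by simp
  then show ?thesis
    using marginal[of t] marginal[of 0] by simp
qed

section \<open>The random coefficients and the candidate series\<close>

locale arch_model = prob_space M
  for M :: "'a measure" +
  fixes \<epsilon> L :: "int \<Rightarrow> 'a \<Rightarrow> real" and \<alpha>\<^sub>0 \<alpha>\<^sub>1 l\<^sub>1 :: real
  assumes iid: "iid_process M \<epsilon>"
    and integrable_sq: "integrable M (\<lambda>\<omega>. (\<epsilon> 0 \<omega>)\<^sup>2)" and variance_1: "(\<integral>\<omega>. (\<epsilon> 0 \<omega>)\<^sup>2 \<partial>M) = 1"
    and stationary: "strictly_stationary M L"
    and pos: "\<And>t. AE \<omega> in M. 0 < L t \<omega>"
    and integrable_L: "integrable M (L 0)" and mean_L: "(\<integral>\<omega>. L 0 \<omega> \<partial>M) = 1"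
    and indep: "indep_processes M L \<epsilon>"
    and \<alpha>\<^sub>0: "0 \<le> \<alpha>\<^sub>0" and \<alpha>\<^sub>1: "0 < \<alpha>\<^sub>1" "\<alpha>\<^sub>1 < 1" and l\<^sub>1: "0 < l\<^sub>1"
begin

abbreviation A :: "int \<Rightarrow> 'a \<Rightarrow> real" where "A \<equiv> arch_A \<alpha>\<^sub>1 \<epsilon>"

abbreviation B :: "int \<Rightarrow> 'a \<Rightarrow> real" where "B \<equiv> arch_B \<alpha>\<^sub>0 l\<^sub>1 L"

text \<open>The coefficient that carries \<open>S (t + 1 - int n)\<close> to
  \<open>S (t + 1)\<close> when the recursion is run over \<open>n\<close> steps.\<close>

definition A_prod :: "int \<Rightarrow> nat \<Rightarrow> 'a \<Rightarrow> real" where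
  "A_prod t n \<omega> = (\<Prod>j<n. A (t - int j) \<omega>)"

definition series_term :: "int \<Rightarrow> nat \<Rightarrow> 'a \<Rightarrow> real" where
  "series_term t i \<omega> = A_prod t i \<omega> * B (t - int i) \<omega>"

text \<open>The series with newest innovation at time \<open>t - 1\<close> gives the squared
  volatility at time \<open>t\<close>. The value on divergent paths is irrelevant, as they form a
  null set.\<close>

definition series_sol :: "int \<Rightarrow> 'a \<Rightarrow> real" where
  "series_sol t \<omega> = (\<Sum>i. series_term (t - 1) i \<omega>)"

lemma indep_eps: "indep_vars (\<lambda>_. borel) \<epsilon> UNIV"
  using iid by (simp add: iid_process_def)

lemma measurable_eps [measurable]: "\<epsilon> t \<in> borel_measurable M"
  using indep_eps by (simp add: indep_vars_def)

lemma measurable_L [measurable]: "L t \<in> borel_measurable M"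
  using stationary by (simp add: strictly_stationary_def)

lemma measurable_A [measurable]: "A t \<in> borel_measurable M"
  unfolding arch_A_def[abs_def] by measurable

lemma measurable_B [measurable]: "B t \<in> borel_measurable M"
  unfolding arch_B_def[abs_def] by measurable

lemma measurable_A_prod [measurable]: "A_prod t n \<in> borel_measurable M"
  unfolding A_prod_def[abs_def] by measurable

lemma measurable_series_term [measurable]: "series_term t i \<in> borel_measurable M"
  unfolding series_term_def[abs_def] by measurable

lemma measurable_series_sol [measurable]: "series_sol t \<in> borel_measurable M"
  unfolding series_sol_def[abs_def] by measurable

lemma A_nonneg: "0 \<le> A t \<omega>"
  using \<alpha>\<^sub>1 by (simp add: arch_A_def)

lemma A_prod_nonneg: "0 \<le> A_prod t n \<omega>"
  unfolding A_prod_def by (intro prod_nonneg ballI A_nonneg)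

lemma A_prod_0 [simp]: "A_prod t 0 \<omega> = 1"
  by (simp add: A_prod_def)

lemma A_prod_Suc: "A_prod t (Suc n) \<omega> = A_prod t n \<omega> * A (t - int n) \<omega>"
  by (simp add: A_prod_def)

text \<open>Peels off the newest factor, as the recursion of the series requires;
  \<open>A_prod_Suc\<close> peels off the oldest, as iterating a solution into the past
  requires.\<close>

lemma A_prod_Suc_shift: "A_prod t (Suc n) \<omega> = A t \<omega> * A_prod (t - 1) n \<omega>"
  unfolding A_prod_def by (subst prod.lessThan_Suc_shift) (simp add: diff_diff_eq add.commute)

lemma AE_B_nonneg: "AE \<omega> in M. 0 \<le> B t \<omega>"
  using pos[of t] by eventually_elim (use \<alpha>\<^sub>0 l\<^sub>1 in \<open>simp add: arch_B_def\<close>)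

lemma AE_series_term_nonneg: "AE \<omega> in M. \<forall>i. 0 \<le> series_term t i \<omega>"
  unfolding AE_all_countable
proof
  fix i
  show "AE \<omega> in M. 0 \<le> series_term t i \<omega>"
    using AE_B_nonneg[of "t - int i"]
    by eventually_elim (simp add: series_term_def A_prod_nonneg)
qed

section \<open>Means of the coefficients, their products and the series terms\<close>

lemma nn_integral_A: "(\<integral>\<^sup>+\<omega>. ennreal (A t \<omega>) \<partial>M) = ennreal \<alpha>\<^sub>1"
proof -
  have "(\<integral>\<^sup>+\<omega>. ennreal (A t \<omega>) \<partial>M) = (\<integral>\<^sup>+x. ennreal (\<alpha>\<^sub>1 * x\<^sup>2) \<partial>distr M borel (\<epsilon> t))"
    by (subst nn_integral_distr) (auto simp: arch_A_def)
  also have "distr M borel (\<epsilon> t) = distr M borel (\<epsilon> 0)"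
    using iid unfolding iid_process_def by blast
  also have "(\<integral>\<^sup>+x. ennreal (\<alpha>\<^sub>1 * x\<^sup>2) \<partial>distr M borel (\<epsilon> 0)) = (\<integral>\<^sup>+\<omega>. ennreal (\<alpha>\<^sub>1 * (\<epsilon> 0 \<omega>)\<^sup>2) \<partial>M)"
    by (subst nn_integral_distr) auto
  also have "\<dots> = ennreal (\<integral>\<omega>. \<alpha>\<^sub>1 * (\<epsilon> 0 \<omega>)\<^sup>2 \<partial>M)"
    using integrable_sq \<alpha>\<^sub>1 by (intro nn_integral_eq_integral) auto
  finally show ?thesis
    by (simp add: variance_1)
qed

text \<open>The factors belong to distinct times, hence are independent, and each has mean
  \<open>\<alpha>\<^sub>1\<close>. Independence is indexed by times, so the product over lags is
  first rewritten over the image set of times.\<close>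

lemma nn_integral_A_prod: "(\<integral>\<^sup>+\<omega>. ennreal (A_prod t n \<omega>) \<partial>M) = ennreal (\<alpha>\<^sub>1 ^ n)"
proof -
  have "indep_vars (\<lambda>_. borel) (\<lambda>s \<omega>. ennreal (\<alpha>\<^sub>1 * (\<epsilon> s \<omega>)\<^sup>2)) UNIV"
    by (rule indep_vars_compose2[OF indep_eps]) measurable
  then have indep: "indep_vars (\<lambda>_. borel) (\<lambda>s \<omega>. ennreal (A s \<omega>)) ((\<lambda>j. t - int j) ` {..<n})"
    by (auto simp: arch_A_def intro: indep_vars_subset)
  have inj: "inj_on (\<lambda>j. t - int j) {..<n}"
    by (auto intro: inj_onI)
  have "(\<integral>\<^sup>+\<omega>. ennreal (A_prod t n \<omega>) \<partial>M)
      = (\<integral>\<^sup>+\<omega>. (\<Prod>s\<in>(\<lambda>j. t - int j) ` {..<n}. ennreal (A s \<omega>)) \<partial>M)"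
    by (simp add: A_prod_def prod_ennreal A_nonneg prod.reindex[OF inj] o_def)
  also have "\<dots> = (\<Prod>s\<in>(\<lambda>j. t - int j) ` {..<n}. \<integral>\<^sup>+\<omega>. ennreal (A s \<omega>) \<partial>M)"
    by (rule indep_vars_nn_integral) (use indep in auto)
  also have "\<dots> = ennreal (\<alpha>\<^sub>1 ^ n)"
    using \<alpha>\<^sub>1 by (simp add: nn_integral_A card_image[OF inj] ennreal_power)
  finally show ?thesis .
qed

lemma nn_integral_B: "(\<integral>\<^sup>+\<omega>. ennreal (B t \<omega>) \<partial>M) = ennreal (\<alpha>\<^sub>0 + l\<^sub>1)"
proof -
  have "(\<integral>\<^sup>+\<omega>. ennreal (B t \<omega>) \<partial>M) = (\<integral>\<^sup>+\<omega>. ennreal (B 0 \<omega>) \<partial>M)"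
    unfolding arch_B_def
    by (rule strictly_stationary_nn_integral[OF stationary, of "\<lambda>x. ennreal (\<alpha>\<^sub>0 + l\<^sub>1 * x)"]) simp
  also have "\<dots> = ennreal (\<integral>\<omega>. B 0 \<omega> \<partial>M)"
    using integrable_L AE_B_nonneg by (intro nn_integral_eq_integral) (auto simp: arch_B_def[abs_def])
  also have "(\<integral>\<omega>. B 0 \<omega> \<partial>M) = \<alpha>\<^sub>0 + l\<^sub>1"
    using integrable_L by (simp add: arch_B_def mean_L prob_space)
  finally show ?thesis .
qed

text \<open>The product of the \<open>A\<close> factors is a functional of the innovations and the
  \<open>B\<close> factor one of the liquidity, so independence of the two processes separates the
  expectations.\<close>

lemma nn_integral_series_term:
  "(\<integral>\<^sup>+\<omega>. ennreal (series_term t i \<omega>) \<partial>M) = ennreal (\<alpha>\<^sub>1 ^ i * (\<alpha>\<^sub>0 + l\<^sub>1))"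
proof -
  \<comment> \<open>Independence is given for whole trajectories, so both factors are written as
    measurable functions on the trajectory space.\<close>
  let ?f = "\<lambda>x::int \<Rightarrow> real. ennreal (\<alpha>\<^sub>0 + l\<^sub>1 * x (t - int i))"
  let ?g = "\<lambda>x::int \<Rightarrow> real. ennreal (\<Prod>j<i. \<alpha>\<^sub>1 * (x (t - int j))\<^sup>2)"
  have "indep_var borel (?f \<circ> (\<lambda>\<omega> s. L s \<omega>)) borel (?g \<circ> (\<lambda>\<omega> s. \<epsilon> s \<omega>))"
    by (rule indep_var_compose[OF indep[unfolded indep_processes_def]]) measurable
  then have "indep_var borel (\<lambda>\<omega>. ennreal (B (t - int i) \<omega>)) borel (\<lambda>\<omega>. ennreal (A_prod t i \<omega>))"
    by (simp add: o_def arch_B_def arch_A_def A_prod_def)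
  then have "(\<integral>\<^sup>+\<omega>. ennreal (B (t - int i) \<omega>) * ennreal (A_prod t i \<omega>) \<partial>M)
      = ennreal (\<alpha>\<^sub>0 + l\<^sub>1) * ennreal (\<alpha>\<^sub>1 ^ i)"
    by (simp add: indep_var_nn_integral nn_integral_B nn_integral_A_prod)
  then show ?thesis
    using \<alpha>\<^sub>0 \<alpha>\<^sub>1 l\<^sub>1 by (simp add: series_term_def ennreal_mult' ennreal_mult'' A_prod_nonneg mult.commute)
qed

section \<open>Existence: the series converges and solves the recursion with bounded mean\<close>

lemma summable_mean_series_term: "summable (\<lambda>i. \<alpha>\<^sub>1 ^ i * (\<alpha>\<^sub>0 + l\<^sub>1))"
  using \<alpha>\<^sub>1 by (intro summable_mult2 summable_geometric) simp

lemma AE_summable_series_term: "AE \<omega> in M. summable (\<lambda>i. series_term t i \<omega>)"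
proof (rule AE_summable_nn_integral[where c = "\<lambda>i. \<alpha>\<^sub>1 ^ i * (\<alpha>\<^sub>0 + l\<^sub>1)"])
  show "AE \<omega> in M. 0 \<le> series_term t n \<omega>" for n
    using AE_series_term_nonneg[of t] by eventually_elim simp
qed (use \<alpha>\<^sub>0 \<alpha>\<^sub>1 l\<^sub>1 in \<open>auto simp: nn_integral_series_term summable_mean_series_term\<close>)

lemma arch_solution_series_sol: "arch_solution M \<alpha>\<^sub>0 \<alpha>\<^sub>1 l\<^sub>1 \<epsilon> L series_sol"
  unfolding arch_solution_def
proof (intro conjI allI)
  fix t
  show "AE \<omega> in M. 0 \<le> series_sol t \<omega>"
    using AE_series_term_nonneg[of "t - 1"] AE_summable_series_term[of "t - 1"]
    by eventually_elim (simp add: series_sol_def suminf_nonneg)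
  show "AE \<omega> in M. series_sol (t + 1) \<omega> = A t \<omega> * series_sol t \<omega> + B t \<omega>"
    using AE_summable_series_term[of t] AE_summable_series_term[of "t - 1"]
  proof eventually_elim
    fix \<omega>
    assume summable: "summable (\<lambda>i. series_term t i \<omega>)" "summable (\<lambda>i. series_term (t - 1) i \<omega>)"
    \<comment> \<open>The head of the series at \<open>t\<close> is \<open>B t\<close>, because the
      empty product is 1; the tail is \<open>A t\<close> times the series at
      \<open>t - 1\<close>.\<close>
    have "series_term t (Suc i) \<omega> = A t \<omega> * series_term (t - 1) i \<omega>" for i
      by (simp add: series_term_def A_prod_Suc_shift diff_diff_eq add.commute)
    then have "(\<Sum>i. series_term t i \<omega>) = A t \<omega> * (\<Sum>i. series_term (t - 1) i \<omega>) + B t \<omega>"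
      using suminf_split_head[OF summable(1)] suminf_mult[OF summable(2)]
      by (simp add: series_term_def)
    then show "series_sol (t + 1) \<omega> = A t \<omega> * series_sol t \<omega> + B t \<omega>"
      by (simp add: series_sol_def)
  qed
qed simp

text \<open>By Tonelli the mean is a geometric series that does not depend on \<open>t\<close>, so
  one finite bound serves all times.\<close>

lemma bounded_mean_series_sol: "bounded_mean M series_sol"
proof -
  have "(\<integral>\<^sup>+\<omega>. ennreal (series_sol t \<omega>) \<partial>M) \<le> ennreal (\<Sum>i. \<alpha>\<^sub>1 ^ i * (\<alpha>\<^sub>0 + l\<^sub>1))" for t
  proof -
    have "(\<integral>\<^sup>+\<omega>. ennreal (series_sol t \<omega>) \<partial>M) = (\<integral>\<^sup>+\<omega>. (\<Sum>i. ennreal (series_term (t - 1) i \<omega>)) \<partial>M)"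
    proof (rule nn_integral_cong_AE)
      show "AE \<omega> in M. ennreal (series_sol t \<omega>) = (\<Sum>i. ennreal (series_term (t - 1) i \<omega>))"
        using AE_series_term_nonneg[of "t - 1"] AE_summable_series_term[of "t - 1"]
        by eventually_elim (simp add: series_sol_def suminf_ennreal2)
    qed
    also have "\<dots> = (\<Sum>i. \<integral>\<^sup>+\<omega>. ennreal (series_term (t - 1) i \<omega>) \<partial>M)"
      by (rule nn_integral_suminf) simp
    also have "\<dots> = ennreal (\<Sum>i. \<alpha>\<^sub>1 ^ i * (\<alpha>\<^sub>0 + l\<^sub>1))"
      unfolding nn_integral_series_term
      by (rule suminf_ennreal2) (use \<alpha>\<^sub>0 \<alpha>\<^sub>1 l\<^sub>1 summable_mean_series_term in auto)
    finally show ?thesis by simp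
  qed
  then have "(SUP t. \<integral>\<^sup>+\<omega>. ennreal (series_sol t \<omega>) \<partial>M) \<le> ennreal (\<Sum>i. \<alpha>\<^sub>1 ^ i * (\<alpha>\<^sub>0 + l\<^sub>1))"
    by (intro SUP_least)
  then show ?thesis
    unfolding bounded_mean_def by (rule le_less_trans) simp
qed

section \<open>Uniqueness: the remainder vanishes and every solution is the series\<close>

lemma AE_remainder_tendsto_0:
  assumes [measurable]: "\<And>t. S t \<in> borel_measurable M"
    and nonneg: "\<And>t. AE \<omega> in M. 0 \<le> S t \<omega>" and "bounded_mean M S"
  shows "AE \<omega> in M. (\<lambda>n. A_prod t n \<omega> * S (t + 1 - int n) \<omega>) \<longlonglongrightarrow> 0"
proof -
  \<comment> \<open>The first family of means is \<open>(\<alpha>\<^sub>1 / r) ^ n\<close> and the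
    second is at most a constant times \<open>r ^ n\<close>, so any \<open>r\<close> strictly
    between \<open>\<alpha>\<^sub>1\<close> and 1 would do; the square root balances the two
    rates.\<close>
  define r where "r = sqrt \<alpha>\<^sub>1"
  have r: "0 < r" "r < 1" "\<alpha>\<^sub>1 = r * r"
    using \<alpha>\<^sub>1 by (simp_all add: r_def)
  obtain C where C: "0 \<le> C" "(SUP t. \<integral>\<^sup>+\<omega>. ennreal (S t \<omega>) \<partial>M) = ennreal C"
    using \<open>bounded_mean M S\<close> unfolding bounded_mean_def by (auto simp: less_top_ennreal)
  have mean_S: "(\<integral>\<^sup>+\<omega>. ennreal (S s \<omega>) \<partial>M) \<le> ennreal C" for s
    unfolding C(2)[symmetric] by (rule SUP_upper) simp
  have "AE \<omega> in M. summable (\<lambda>n. A_prod t n \<omega> / r ^ n)"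
  proof (rule AE_summable_nn_integral[where c = "\<lambda>n. r ^ n"])
    fix n
    have "(\<integral>\<^sup>+\<omega>. ennreal (A_prod t n \<omega> / r ^ n) \<partial>M)
        = (\<integral>\<^sup>+\<omega>. ennreal (1 / r ^ n) * ennreal (A_prod t n \<omega>) \<partial>M)"
      using r by (intro nn_integral_cong) (simp add: ennreal_mult'[symmetric])
    also have "\<dots> = ennreal (1 / r ^ n) * ennreal (\<alpha>\<^sub>1 ^ n)"
      by (simp add: nn_integral_cmult nn_integral_A_prod)
    also have "\<dots> = ennreal (r ^ n)"
      using r by (simp add: ennreal_mult'[symmetric] power_mult_distrib)
    finally show "(\<integral>\<^sup>+\<omega>. ennreal (A_prod t n \<omega> / r ^ n) \<partial>M) \<le> ennreal (r ^ n)" by simp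
  qed (use r(1,2) in \<open>auto simp: A_prod_nonneg summable_geometric\<close>)
  moreover have "AE \<omega> in M. summable (\<lambda>n. r ^ n * S (t + 1 - int n) \<omega>)"
  proof (rule AE_summable_nn_integral[where c = "\<lambda>n. r ^ n * C"])
    fix n
    show "AE \<omega> in M. 0 \<le> r ^ n * S (t + 1 - int n) \<omega>"
      using nonneg[of "t + 1 - int n"] by eventually_elim (use r in simp)
    have "(\<integral>\<^sup>+\<omega>. ennreal (r ^ n * S (t + 1 - int n) \<omega>) \<partial>M)
        = ennreal (r ^ n) * (\<integral>\<^sup>+\<omega>. ennreal (S (t + 1 - int n) \<omega>) \<partial>M)"
      using r by (simp add: ennreal_mult' nn_integral_cmult)
    also have "\<dots> \<le> ennreal (r ^ n) * ennreal C"
      by (intro mult_left_mono mean_S) simp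
    finally show "(\<integral>\<^sup>+\<omega>. ennreal (r ^ n * S (t + 1 - int n) \<omega>) \<partial>M) \<le> ennreal (r ^ n * C)"
      using r by (simp add: ennreal_mult')
  qed (use r C in \<open>auto intro!: summable_mult2 summable_geometric\<close>)
  ultimately show ?thesis
  proof eventually_elim
    fix \<omega>
    assume "summable (\<lambda>n. A_prod t n \<omega> / r ^ n)" "summable (\<lambda>n. r ^ n * S (t + 1 - int n) \<omega>)"
    \<comment> \<open>The weights \<open>r ^ n\<close> cancel in the product of the two null
      sequences, leaving the remainder.\<close>
    from tendsto_mult[OF this[THEN summable_LIMSEQ_zero]]
    show "(\<lambda>n. A_prod t n \<omega> * S (t + 1 - int n) \<omega>) \<longlonglongrightarrow> 0"
      using r by (simp add: field_simps)
  qed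
qed

text \<open>The partial sums differ from \<open>S (t + 1)\<close> by exactly the remainder, so
  convergence and the value of the limit come together.\<close>

lemma AE_solution_sums:
  assumes sol: "arch_solution M \<alpha>\<^sub>0 \<alpha>\<^sub>1 l\<^sub>1 \<epsilon> L S" and "bounded_mean M S"
  shows "AE \<omega> in M. (\<lambda>i. series_term t i \<omega>) sums S (t + 1) \<omega>"
proof -
  \<comment> \<open>There are countably many times, so a single null set can be discarded for the
    recursion at all of them; the pathwise induction uses it at every
    \<open>t - int n\<close>.\<close>
  have "AE \<omega> in M. \<forall>t. S (t + 1) \<omega> = A t \<omega> * S t \<omega> + B t \<omega>"
    using sol by (simp add: arch_solution_def AE_all_countable)
  moreover have "AE \<omega> in M. (\<lambda>n. A_prod t n \<omega> * S (t + 1 - int n) \<omega>) \<longlonglongrightarrow> 0"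
    using sol \<open>bounded_mean M S\<close> by (intro AE_remainder_tendsto_0) (auto simp: arch_solution_def)
  ultimately show ?thesis
  proof eventually_elim
    fix \<omega>
    assume rec: "\<forall>t. S (t + 1) \<omega> = A t \<omega> * S t \<omega> + B t \<omega>"
      and lim: "(\<lambda>n. A_prod t n \<omega> * S (t + 1 - int n) \<omega>) \<longlonglongrightarrow> 0"
    have iterate: "(\<Sum>i<n. series_term t i \<omega>) = S (t + 1) \<omega> - A_prod t n \<omega> * S (t + 1 - int n) \<omega>" for n
    proof (induction n)
      case (Suc n)
      \<comment> \<open>The recursion at time \<open>t - int n\<close> turns the old remainder into
        the next series term plus the new remainder.\<close>
      have "S (t + 1 - int n) \<omega> = A (t - int n) \<omega> * S (t - int n) \<omega> + B (t - int n) \<omega>"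
        using rec[rule_format, of "t - int n"] by (simp add: algebra_simps)
      with Suc show ?case
        by (simp add: series_term_def A_prod_Suc algebra_simps)
    qed simp
    show "(\<lambda>i. series_term t i \<omega>) sums S (t + 1) \<omega>"
      unfolding sums_def iterate using tendsto_diff[OF tendsto_const lim] by simp
  qed
qed

text \<open>The series terms do not involve the solution, so \<open>S t\<close> and
  \<open>S' t\<close> are sums of the same series, the one started at \<open>t - 1\<close>.\<close>

lemma AE_solution_unique:
  assumes "arch_solution M \<alpha>\<^sub>0 \<alpha>\<^sub>1 l\<^sub>1 \<epsilon> L S" "bounded_mean M S"
    and "arch_solution M \<alpha>\<^sub>0 \<alpha>\<^sub>1 l\<^sub>1 \<epsilon> L S'" "bounded_mean M S'"
  shows "AE \<omega> in M. S t \<omega> = S' t \<omega>"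
  using AE_solution_sums[OF assms(1,2), of "t - 1"] AE_solution_sums[OF assms(3,4), of "t - 1"]
  by eventually_elim (auto dest: sums_unique2)

end

theorem corollary2p3:
  fixes M :: "'a measure"
    and \<epsilon> L :: "int \<Rightarrow> 'a \<Rightarrow> real"
    and \<alpha>\<^sub>0 \<alpha>\<^sub>1 l\<^sub>1 :: real
  assumes "prob_space M"
    and "iid_process M \<epsilon>"
    and "integrable M (\<epsilon> 0)" and "(\<integral>\<omega>. \<epsilon> 0 \<omega> \<partial>M) = 0"
    and "integrable M (\<lambda>\<omega>. (\<epsilon> 0 \<omega>)\<^sup>2)" and "(\<integral>\<omega>. (\<epsilon> 0 \<omega>)\<^sup>2 \<partial>M) = 1"
    and "strictly_stationary M L"
    and "\<And>t. AE \<omega> in M. 0 < L t \<omega>"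
    and "integrable M (L 0)" and "(\<integral>\<omega>. L 0 \<omega> \<partial>M) = 1"
    and "indep_processes M L \<epsilon>"
    and "0 \<le> \<alpha>\<^sub>0" and "0 < \<alpha>\<^sub>1" and "0 < l\<^sub>1"
    and "\<alpha>\<^sub>1 < 1"
    and "integrable M (\<lambda>\<omega>. (L 0 \<omega>)\<^sup>2)"
  shows "(\<exists>S. arch_solution M \<alpha>\<^sub>0 \<alpha>\<^sub>1 l\<^sub>1 \<epsilon> L S \<and> bounded_mean M S) \<and>
    (\<forall>S S'. arch_solution M \<alpha>\<^sub>0 \<alpha>\<^sub>1 l\<^sub>1 \<epsilon> L S \<and> bounded_mean M S \<and>
            arch_solution M \<alpha>\<^sub>0 \<alpha>\<^sub>1 l\<^sub>1 \<epsilon> L S' \<and> bounded_mean M S' \<longrightarrow>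
            (\<forall>t. AE \<omega> in M. S t \<omega> = S' t \<omega>)) \<and>
    (\<forall>S. arch_solution M \<alpha>\<^sub>0 \<alpha>\<^sub>1 l\<^sub>1 \<epsilon> L S \<and> bounded_mean M S \<longrightarrow>
         (\<forall>t. AE \<omega> in M.
            (\<lambda>i. (\<Prod>j<i. arch_A \<alpha>\<^sub>1 \<epsilon> (t - int j) \<omega>) * arch_B \<alpha>\<^sub>0 l\<^sub>1 L (t - int i) \<omega>)
              sums S (t + 1) \<omega>))"
proof -
  interpret prob_space M by fact
  interpret arch_model M \<epsilon> L \<alpha>\<^sub>0 \<alpha>\<^sub>1 l\<^sub>1
    by unfold_locales (fact assms)+
  show ?thesis
    using arch_solution_series_sol bounded_mean_series_sol AE_solution_unique
      AE_solution_sums[unfolded series_term_def A_prod_def]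
    by blast
qed

end
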